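(* In the setting of the context, for every $\beta>0$ there exists a constant $\tau>0$, depending only on $\theta,\lambda,c,\beta$ (and not on the initial condition $u_0$), such that for every $u_0\in L^2(0,1)$ the event times of the closed-loop system under the event-triggered boundary control satisfy $t_{j+1}-t_j\ge\tau$ for all $j\ge0$ (for which $t_{j+1}$ is defined). In particular, no Zeno behaviour occurs.
   Context: Standing setting. Fix $\theta>0$, $\lambda\in\mathbb{R}$ with $\lambda\ge\theta\pi^2$, and a design parameter $c\ge0$; set $\kappa:=(\lambda+c)/\theta>0$. Define the kernel on $\{0\le y\le x\le1\}$ by $K(x,y)=-y\kappa\,\frac{I_1(\sqrt{\kappa(x^2-y^2)})}{\sqrt{\kappa(x^2-y^2)}}$ (extended continuously to $y=x$ by the value $-y\kappa/2$), where $I_1$ is the modified Bessel function of the first kind of order 1, and let $k(y):=K(1,y)$, $y\in[0,1]$. $\|\cdot\|$ is the $L^2(0,1)$ norm and $u[t]$ denotes $x\mapsto u(t,x)$. The closed-loop system is $u_t=\theta u_{xx}+\lambda u$ on $(0,1)$, $u(t,0)=0$, $u(t,1)=U_d(t)$, $u[0]=u_0\in L^2(0,1)$, under the event-triggered boundary control with parameter $\beta>0$ defined as follows. Set $t_0=0$. Given an event time $t_j$ and $u[t_j]$, let $u$ on $[t_j,\infty)$ be the (unique) solution with held boundary value $U_d(t)=\int_0^1k(y)u(t_j,y)\,dy$, where solution means: $t\mapsto u[t]$ continuous into $L^2(0,1)$ on $[t_j,\infty)$, $u\in C^1$ on $(t_j,\infty)\times[0,1]$, $u[t]\in C^2([0,1])$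 for $t>t_j$, PDE and boundary conditions holding pointwise. Let $d(t):=\int_0^1k(y)\big(u(t_j,y)-u(t,y)\big)dy$ and $S_j:=\{t>t_j:\ |d(t)|>\beta\|k\|\,\|u[t]\|+\beta\|k\|\,\|u[t_j]\|\}$. If $S_j=\emptyset$ there are no further events ($t_{j+1}:=+\infty$); otherwise $t_{j+1}:=\inf S_j$, the control is $U_d(t)=\int_0^1k(y)u(t_j,y)dy$ for $t\in[t_j,t_{j+1})$, and the construction is repeated from $t_{j+1}$. *)

theory Defs
  imports "HOL-Analysis.Analysis"
begin

definition bessel_I1 :: "real \<Rightarrow> real" where
  "bessel_I1 z = (\<Sum>m. (z / 2) ^ (2 * m + 1) / (fact m * fact (m + 1)))"

definition kappa :: "real \<Rightarrow> real \<Rightarrow> real \<Rightarrow> real" where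
  "kappa th lam c = (lam + c) / th"

text \<open>Backstepping kernel K(x,y), extended continuously to y = x by -y kappa / 2.\<close>
definition kernelK :: "real \<Rightarrow> real \<Rightarrow> real \<Rightarrow> real \<Rightarrow> real \<Rightarrow> real" where
  "kernelK th lam c x y =
     (let \<kappa> = kappa th lam c; s = sqrt (\<kappa> * (x\<^sup>2 - y\<^sup>2)) in
      if s = 0 then - y * \<kappa> / 2 else - y * \<kappa> * bessel_I1 s / s)"

definition gain_k :: "real \<Rightarrow> real \<Rightarrow> real \<Rightarrow> real \<Rightarrow> real" where
  "gain_k th lam c y = kernelK th lam c 1 y"

definition L2norm :: "(real \<Rightarrow> real) \<Rightarrow> real" where
  "L2norm f = sqrt (integral {0..1} (\<lambda>y. (f y)\<^sup>2))"

definition in_L2 :: "(real \<Rightarrow> real) \<Rightarrow> bool" where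
  "in_L2 f \<longleftrightarrow> f measurable_on {0..1} \<and> (\<lambda>y. (f y)\<^sup>2) integrable_on {0..1}"

definition is_solution ::
  "real \<Rightarrow> real \<Rightarrow> real \<Rightarrow> (real \<Rightarrow> real) \<Rightarrow> real \<Rightarrow> (real \<Rightarrow> real \<Rightarrow> real) \<Rightarrow> bool" where
  "is_solution th lam s g U w \<longleftrightarrow>
     (\<forall>y\<in>{0..1}. w s y = g y) \<and>
     (\<forall>t\<ge>s. in_L2 (w t)) \<and>
     (\<forall>t0\<ge>s. ((\<lambda>t. L2norm (\<lambda>y. w t y - w t0 y)) \<longlongrightarrow> 0) (at t0 within {s..})) \<and>
     (\<exists>wt wx wxx.
        (\<forall>t>s. \<forall>x\<in>{0..1}.
           ((\<lambda>r. w r x) has_real_derivative wt t x) (at t) \<and>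
           ((\<lambda>\<xi>. w t \<xi>) has_real_derivative wx t x) (at x within {0..1}) \<and>
           ((\<lambda>\<xi>. wx t \<xi>) has_real_derivative wxx t x) (at x within {0..1}) \<and>
           wt t x = th * wxx t x + lam * w t x) \<and>
        continuous_on ({s<..} \<times> {0..1}) (\<lambda>(t, x). w t x) \<and>
        continuous_on ({s<..} \<times> {0..1}) (\<lambda>(t, x). wt t x) \<and>
        continuous_on ({s<..} \<times> {0..1}) (\<lambda>(t, x). wx t x) \<and>
        (\<forall>t>s. continuous_on {0..1} (wxx t))) \<and>
     (\<forall>t>s. w t 0 = 0 \<and> w t 1 = U)"

definition held_control :: "real \<Rightarrow> real \<Rightarrow> real \<Rightarrow> (real \<Rightarrow> real) \<Rightarrow> real" where
  "held_control th lam c v = integral {0..1} (\<lambda>y. gain_k th lam c y * v y)"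

definition trigger_set ::
  "real \<Rightarrow> real \<Rightarrow> real \<Rightarrow> real \<Rightarrow> real \<Rightarrow> (real \<Rightarrow> real \<Rightarrow> real) \<Rightarrow> real set" where
  "trigger_set th lam c \<beta> s w =
     {t. t > s \<and>
         \<bar>integral {0..1} (\<lambda>y. gain_k th lam c y * (w s y - w t y))\<bar>
           > \<beta> * L2norm (gain_k th lam c) * L2norm (w t)
             + \<beta> * L2norm (gain_k th lam c) * L2norm (w s)}"

text \<open>Closed loop under event-triggered control: event times tt (with value \<infinity> meaning
  "no further events") and segment solutions ws j on [t_j,\<infinity>).
  Segment j starts from u0 (j = 0) or from the state of segment j-1 at t_j.\<close>
definition event_triggered_closed_loop ::
  "real \<Rightarrow> real \<Rightarrow> real \<Rightarrow> real \<Rightarrow> (real \<Rightarrow> real) \<Rightarrow> (nat \<Rightarrow> ereal)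
    \<Rightarrow> (nat \<Rightarrow> real \<Rightarrow> real \<Rightarrow> real) \<Rightarrow> bool" where
  "event_triggered_closed_loop th lam c \<beta> u0 tt ws \<longleftrightarrow>
     tt 0 = 0 \<and>
     (\<forall>j. tt j = \<infinity> \<longrightarrow> tt (Suc j) = \<infinity>) \<and>
     (\<forall>j. tt j \<noteq> \<infinity> \<longrightarrow>
        (let s = real_of_ereal (tt j);
             g = (if j = 0 then u0 else ws (j - 1) s)
         in is_solution th lam s g (held_control th lam c g) (ws j) \<and>
            tt (Suc j) = (if trigger_set th lam c \<beta> s (ws j) = {} then \<infinity>
                          else ereal (Inf (trigger_set th lam c \<beta> s (ws j))))))"

end

(* Replace the gain k by a smooth phi with phi(0) = phi(1) = phi'(1) = 0 and
   ||k - phi|| <= (beta/2) ||k||.  The error k - phi accounts for at most half of the trigger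
   threshold.  Since phi kills the boundary terms, t |-> <phi, u[t]> has derivative
   <theta phi'' + lambda phi, u[t]>, which an energy estimate for u - x U_d bounds by a constant
   times ||u[t_j]|| on an interval of length 1; so it takes a time tau, depending only on the
   parameters, to use up the other half. *)
theory Submission
  imports Defs
begin

text \<open>The gain cannot be paired with the equation directly: k(1) = -kappa/2 is nonzero, so the
  derivative of <k, u[t]> would contain the flux u_x(t,1), which L2 data do not control near t_j.
  The trigger sees k only through pairings that Cauchy-Schwarz bounds by L2 norms, and endpoint
  values are invisible in L2, so zeros there can be imposed at arbitrarily small cost. The
  approximation error is charged to both norms in the threshold; the drift of <phi, u[t]> is charged
  to the ||u[t_j]|| term alone, because the energy estimate bounds ||u[t]|| only from above. Every
  bound, including |U_d| <= ||k|| ||u[t_j]||, is linear in ||u[t_j]||, which therefore scales out: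
  this makes \<open>\<tau>\<close> uniform in the initial state and in j.\<close>

section \<open>Square-integrable functions on [0,1]\<close>

lemma in_L2_mult_integrable:
  assumes "in_L2 f" "in_L2 g"
  shows "(\<lambda>y. f y * g y) integrable_on {0..1}"
proof (rule measurable_bounded_by_integrable_imp_integrable_real)
  show "(\<lambda>y. f y * g y) \<in> borel_measurable (lebesgue_on {0..1})"
    using assms unfolding in_L2_def
    by (intro borel_measurable_times measurable_on_imp_borel_measurable_lebesgue) auto
  show "(\<lambda>y. (f y)\<^sup>2 + (g y)\<^sup>2) integrable_on {0..1}"
    using assms unfolding in_L2_def by (intro integrable_add) auto
  show "\<bar>f x * g x\<bar> \<le> (f x)\<^sup>2 + (g x)\<^sup>2" for x
    using sum_squares_bound[of "\<bar>f x\<bar>" "\<bar>g x\<bar>"] abs_ge_zero[of "f x * g x"]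
    unfolding abs_mult power2_abs by linarith
qed simp

lemma in_L2_add:
  assumes "in_L2 f" "in_L2 g"
  shows "in_L2 (\<lambda>y. f y + g y)"
  unfolding in_L2_def
proof
  show "(\<lambda>y. f y + g y) measurable_on {0..1}"
    using assms unfolding in_L2_def by (intro measurable_on_add) auto
  have "(\<lambda>y. (f y)\<^sup>2 + (g y)\<^sup>2 + 2 * (f y * g y)) integrable_on {0..1}"
    using assms in_L2_mult_integrable[OF assms]
    unfolding in_L2_def by (intro integrable_add integrable_on_mult_right) auto
  then show "(\<lambda>y. (f y + g y)\<^sup>2) integrable_on {0..1}"
    by (simp add: power2_sum algebra_simps)
qed

lemma in_L2_cmult:
  assumes "in_L2 f"
  shows "in_L2 (\<lambda>y. a * f y)"
  using assms unfolding in_L2_def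
  by (auto simp: power_mult_distrib intro: measurable_on_cmul integrable_on_mult_right)

lemma in_L2_diff:
  assumes "in_L2 f" "in_L2 g"
  shows "in_L2 (\<lambda>y. f y - g y)"
  using in_L2_add[OF assms(1) in_L2_cmult[OF assms(2), of "-1"]] by simp

lemma in_L2_continuous:
  assumes "continuous_on {0..1} f"
  shows "in_L2 f"
  unfolding in_L2_def
proof
  show "f measurable_on {0..1}"
    using assms
    by (simp add: measurable_on_iff_borel_measurable continuous_imp_measurable_on_sets_lebesgue)
  show "(\<lambda>y. (f y)\<^sup>2) integrable_on {0..1}"
    using assms by (intro integrable_continuous_interval continuous_intros)
qed

lemma integral_square_nonneg: "0 \<le> integral {0..1} (\<lambda>y::real. (f y :: real)\<^sup>2)"
  \<comment> \<open>\<open>integral\<close> takes the value 0 on a non-integrable function, so the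
    bound holds for every \<open>f\<close>.\<close>
  by (cases "(\<lambda>y. (f y)\<^sup>2) integrable_on {0..1}")
     (auto intro: integral_nonneg simp: not_integrable_integral)

lemma L2norm_nonneg [simp]: "0 \<le> L2norm f"
  unfolding L2norm_def by (simp add: integral_square_nonneg)

lemma L2norm_sq: "(L2norm f)\<^sup>2 = integral {0..1} (\<lambda>y. (f y)\<^sup>2)"
  unfolding L2norm_def by (simp add: integral_square_nonneg)

lemma L2norm_cmult: "L2norm (\<lambda>y. a * f y) = \<bar>a\<bar> * L2norm f"
  unfolding L2norm_def by (simp add: power_mult_distrib real_sqrt_mult)

lemma L2norm_add_sq:
  assumes "in_L2 f" "in_L2 g"
  shows "(L2norm (\<lambda>y. f y + g y))\<^sup>2 =
    (L2norm f)\<^sup>2 + 2 * integral {0..1} (\<lambda>y. f y * g y) + (L2norm g)\<^sup>2"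
proof -
  have "integral {0..1} (\<lambda>y. (f y + g y)\<^sup>2) =
      integral {0..1} (\<lambda>y. ((f y)\<^sup>2 + 2 * (f y * g y)) + (g y)\<^sup>2)"
    by (simp add: power2_sum algebra_simps)
  also have "\<dots> = integral {0..1} (\<lambda>y. (f y)\<^sup>2) + integral {0..1} (\<lambda>y. 2 * (f y * g y))
      + integral {0..1} (\<lambda>y. (g y)\<^sup>2)"
    using assms in_L2_mult_integrable[OF assms] unfolding in_L2_def
    by (subst integral_add integrable_add, auto intro!: integrable_add)+
  finally show ?thesis by (simp add: L2norm_sq)
qed

text \<open>\<open>pos\<close> expands ||f + a g||^2 >= 0 as a quadratic in \<open>a\<close>; its
  minimizer a = -B / ||g||^2 yields the bound.\<close>

lemma L2_Cauchy_Schwarz: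
  assumes "in_L2 f" "in_L2 g"
  shows "\<bar>integral {0..1} (\<lambda>y. f y * g y)\<bar> \<le> L2norm f * L2norm g"
proof -
  define B where "B = integral {0..1} (\<lambda>y. f y * g y)"
  have pos: "0 \<le> (L2norm f)\<^sup>2 + 2 * a * B + a\<^sup>2 * (L2norm g)\<^sup>2" for a
  proof -
    have "0 \<le> (L2norm (\<lambda>y. f y + a * g y))\<^sup>2" by simp
    also have "\<dots> = (L2norm f)\<^sup>2 + 2 * integral {0..1} (\<lambda>y. f y * (a * g y))
        + (L2norm (\<lambda>y. a * g y))\<^sup>2"
      by (intro L2norm_add_sq in_L2_cmult assms)
    also have "integral {0..1} (\<lambda>y. f y * (a * g y)) = a * B"
      unfolding B_def by (simp add: mult.left_commute)
    finally show ?thesis by (simp add: L2norm_cmult power_mult_distrib)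
  qed
  have "B\<^sup>2 \<le> (L2norm f * L2norm g)\<^sup>2"
  proof (cases "L2norm g = 0")
    case True
    have "B = 0"
    proof (rule ccontr)
      assume "B \<noteq> 0"
      \<comment> \<open>A vanishing norm does not force \<open>g\<close> to be the zero function.
        The quadratic degenerates to an affine function of \<open>a\<close>, and this
        \<open>a\<close> gives it the value -1.\<close>
      with pos[of "- ((L2norm f)\<^sup>2 + 1) / (2 * B)"] True show False by (simp add: field_simps)
    qed
    then show ?thesis by simp
  next
    case False
    then have "0 \<le> (L2norm f)\<^sup>2 - B\<^sup>2 / (L2norm g)\<^sup>2"
      using pos[of "- B / (L2norm g)\<^sup>2"] by (simp add: field_simps power2_eq_square)
    with False show ?thesis by (simp add: field_simps power_mult_distrib)
  qed
  then have "\<bar>B\<bar> \<le> \<bar>L2norm f * L2norm g\<bar>" by (simp only: abs_le_square_iff)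
  then show ?thesis unfolding B_def by (simp add: abs_mult)
qed

lemma L2norm_triangle:
  assumes "in_L2 f" "in_L2 g"
  shows "L2norm (\<lambda>y. f y + g y) \<le> L2norm f + L2norm g"
proof (rule power2_le_imp_le)
  show "(L2norm (\<lambda>y. f y + g y))\<^sup>2 \<le> (L2norm f + L2norm g)\<^sup>2"
    using L2norm_add_sq[OF assms] L2_Cauchy_Schwarz[OF assms] by (simp add: power2_sum)
qed simp

lemma L2norm_triangle_diff:
  assumes "in_L2 f" "in_L2 g"
  shows "\<bar>L2norm f - L2norm g\<bar> \<le> L2norm (\<lambda>y. f y - g y)"
proof -
  have "L2norm f \<le> L2norm (\<lambda>y. f y - g y) + L2norm g"
    using L2norm_triangle[OF in_L2_diff[OF assms] assms(2)] by simp
  moreover have "L2norm g \<le> L2norm (\<lambda>y. (-1) * (f y - g y)) + L2norm f"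
    using L2norm_triangle[OF in_L2_diff[OF assms(2,1)] assms(1)] by simp
  ultimately show ?thesis unfolding L2norm_cmult by simp
qed

lemma L2norm_le:
  assumes "continuous_on {0..1} f" "continuous_on {0..1} g" "\<And>x. x \<in> {0..1} \<Longrightarrow> (f x)\<^sup>2 \<le> g x"
    and "integral {0..1} g \<le> e\<^sup>2" "0 \<le> e"
  shows "L2norm f \<le> e"
proof (rule power2_le_imp_le)
  have "integral {0..1} (\<lambda>x. (f x)\<^sup>2) \<le> integral {0..1} g"
    using assms(1-3) by (intro integral_le integrable_continuous_interval continuous_intros) auto
  then show "(L2norm f)\<^sup>2 \<le> e\<^sup>2" using assms(4) by (simp add: L2norm_sq)
qed fact

section \<open>Approximation in L2 by polynomials with prescribed zeros\<close>

lemma integral_power_01: "integral {0..1::real} (\<lambda>x. x ^ n) = 1 / (real n + 1)"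
proof (rule integral_unique)
  have "((\<lambda>x. x ^ n) has_integral (1 ^ Suc n / (real n + 1) - 0 ^ Suc n / (real n + 1))) {0..1::real}"
    by (intro fundamental_theorem_of_calculus)
       (auto intro!: derivative_eq_intros simp: add.commute simp del: power_Suc
         simp flip: has_real_derivative_iff_has_vector_derivative)
  then show "((\<lambda>x. x ^ n) has_integral 1 / (real n + 1)) {0..1::real}" by simp
qed

lemma integral_one_minus_power_01: "integral {0..1::real} (\<lambda>x. (1 - x) ^ n) = 1 / (real n + 1)"
proof (rule integral_unique)
  have "((\<lambda>x. (1 - x) ^ n) has_integral
      (- ((1 - 1) ^ Suc n / (real n + 1)) - - ((1 - 0) ^ Suc n / (real n + 1)))) {0..1::real}"
    by (intro fundamental_theorem_of_calculus)
       (auto intro!: derivative_eq_intros simp: add.commute simp del: power_Suc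
         simp flip: has_real_derivative_iff_has_vector_derivative)
  then show "((\<lambda>x. (1 - x) ^ n) has_integral 1 / (real n + 1)) {0..1::real}" by simp
qed

text \<open>A uniform polynomial approximation is multiplied by \<open>(1 - x^n)^2 (1 - (1 - x)^n)\<close>, which
  has the required zeros and tends to 1 in \<open>L\<^sup>2\<close>.\<close>
lemma L2_dense_test_polynomials:
  assumes h: "continuous_on {0..1::real} h" and e: "0 < e"
  obtains \<phi> \<phi>' \<phi>'' where
    "\<And>x. (\<phi> has_real_derivative \<phi>' x) (at x)" "\<And>x. (\<phi>' has_real_derivative \<phi>'' x) (at x)"
    "continuous_on UNIV \<phi>''" "\<phi> 0 = 0" "\<phi> 1 = 0" "\<phi>' 1 = 0" "L2norm (\<lambda>x. h x - \<phi> x) \<le> e"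
proof -
  obtain p where p: "real_polynomial_function p"
    and hp: "\<And>x. x \<in> {0..1} \<Longrightarrow> \<bar>h x - p x\<bar> < e / 2"
    using Stone_Weierstrass_real_polynomial_function[OF compact_Icc h, of "e / 2"] e by auto
  have pc: "continuous_on {0..1} p"
    using p by (simp add: continuous_at_imp_continuous_on continuous_real_polymonial_function)
  obtain B where "\<forall>y\<in>p ` {0..1}. \<bar>y\<bar> \<le> B"
    using compact_imp_bounded[OF compact_continuous_image[OF pc compact_Icc]]
    unfolding bounded_iff real_norm_def by blast
  then have B: "\<And>x. x \<in> {0..1} \<Longrightarrow> \<bar>p x\<bar> \<le> B" by blast
  \<comment> \<open>The majorant \<open>?g\<close> below has integral e^2/2 + 20 B^2 / (n + 1), so
    this \<open>n\<close> brings it under e^2. Positivity of \<open>n\<close> makes the cutoff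
    vanish at both endpoints.\<close>
  obtain n :: nat where n: "40 * B\<^sup>2 / e\<^sup>2 < n" "0 < n"
    using reals_Archimedean2[of "max 1 (40 * B\<^sup>2 / e\<^sup>2)"] by auto
  define \<eta> where "\<eta> = (\<lambda>x::real. (1 - x ^ n)\<^sup>2 * (1 - (1 - x) ^ n))"
  define \<phi> where "\<phi> = (\<lambda>x. p x * \<eta> x)"
  have idp: "real_polynomial_function (\<lambda>x::real. x)"
    by (intro real_polynomial_function.intros bounded_linear_ident)
  \<comment> \<open>Splitting off (1 - x^n)^2 exposes a double zero at 1, from which the derivative
    of \<open>\<phi>\<close> there is read off whatever the cofactor is.\<close>
  define q where "q = (\<lambda>x. p x * (1 - (1 - x) ^ n))"
  have q: "real_polynomial_function q"
    unfolding q_def using p idp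
    by (intro real_polynomial_function.intros(3,4) real_polynomial_function_diff
        real_polynomial_function_power real_polynomial_function.intros(2))
  have \<phi>q: "\<phi> = (\<lambda>x. q x * (1 - x ^ n)\<^sup>2)" unfolding \<phi>_def \<eta>_def q_def by (simp add: fun_eq_iff)
  have \<phi>: "real_polynomial_function \<phi>"
    unfolding \<phi>q using q idp
    by (intro real_polynomial_function.intros(3,4) real_polynomial_function_diff
        real_polynomial_function_power real_polynomial_function.intros(2))
  obtain \<phi>' where \<phi>': "real_polynomial_function \<phi>'" "\<And>x. (\<phi> has_real_derivative \<phi>' x) (at x)"
    using has_real_derivative_polynomial_function[OF \<phi>] by auto
  obtain \<phi>'' where \<phi>'': "real_polynomial_function \<phi>''" "\<And>x. (\<phi>' has_real_derivative \<phi>'' x) (at x)"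
    using has_real_derivative_polynomial_function[OF \<phi>'(1)] by auto
  obtain q' where q': "\<And>x. (q has_real_derivative q' x) (at x)"
    using has_real_derivative_polynomial_function[OF q] by auto
  have "(\<phi> has_real_derivative 0) (at 1)"
    unfolding \<phi>q by (auto intro!: derivative_eq_intros q'[of 1])
  then have "\<phi>' 1 = 0" using \<phi>'(2) DERIV_unique by blast
  have \<phi>c: "continuous_on {0..1} \<phi>"
    using \<phi> by (simp add: continuous_at_imp_continuous_on continuous_real_polymonial_function)
  have "L2norm (\<lambda>x. h x - \<phi> x) \<le> e"
  proof (rule L2norm_le)
    \<comment> \<open>The error splits as (h - p) + p (1 - \<eta>), and (u + v)^2 <= 2 u^2 + 2 v^2.
      The first part contributes 2 (e/2)^2; in the second, 1 - \<eta> is at most 2 x^n + (1 - x)^n,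
      whose square is at most 5 x^n + 5 (1 - x)^n because 2^2 + 1^2 = 5.\<close>
    let ?g = "\<lambda>x. e\<^sup>2 / 2 + 2 * B\<^sup>2 * (5 * x ^ n + 5 * (1 - x) ^ n)"
    show "(h x - \<phi> x)\<^sup>2 \<le> ?g x" if x: "x \<in> {0..1}" for x
    proof -
      define a b where "a = x ^ n" and "b = (1 - x) ^ n"
      have ab: "0 \<le> a" "a \<le> 1" "0 \<le> b" "b \<le> 1"
        using x by (auto simp: a_def b_def power_le_one)
      have "\<bar>1 - \<eta> x\<bar> \<le> 2 * a + b"
      proof -
        have eq: "1 - \<eta> x = (2 * a - a\<^sup>2) + (1 - a)\<^sup>2 * b"
          unfolding \<eta>_def a_def[symmetric] b_def[symmetric] by (simp add: power2_eq_square algebra_simps)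
        have "(1 - a)\<^sup>2 \<le> 1" using ab by (intro power_le_one) auto
        then have "(1 - a)\<^sup>2 * b \<le> b" "0 \<le> (1 - a)\<^sup>2 * b"
          using ab by (auto intro: mult_left_le_one_le)
        moreover have "a\<^sup>2 \<le> a" using ab by (simp add: power2_eq_square mult_left_le_one_le)
        ultimately show ?thesis unfolding eq using ab zero_le_power2[of a] by linarith
      qed
      then have "(1 - \<eta> x)\<^sup>2 \<le> (2 * a + b)\<^sup>2" using ab by (simp add: abs_le_square_iff[symmetric])
      also have "\<dots> \<le> 5 * a\<^sup>2 + 5 * b\<^sup>2"
        using zero_le_power2[of "a - 2 * b"] by (simp add: power2_eq_square algebra_simps)
      also have "\<dots> \<le> 5 * a + 5 * b"
        using ab by (intro add_mono mult_left_mono) (auto simp: power2_eq_square mult_left_le_one_le)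
      finally have \<eta>: "(1 - \<eta> x)\<^sup>2 \<le> 5 * a + 5 * b" .
      have "(p x)\<^sup>2 \<le> B\<^sup>2" using B[OF x] by (auto simp: abs_le_square_iff[symmetric])
      then have P: "(p x * (1 - \<eta> x))\<^sup>2 \<le> B\<^sup>2 * (5 * a + 5 * b)"
        using \<eta> unfolding power_mult_distrib by (intro mult_mono) auto
      have H: "(h x - p x)\<^sup>2 \<le> (e / 2)\<^sup>2"
        using hp[OF x] e by (auto simp: abs_le_square_iff[symmetric])
      have sq_add: "(u + v)\<^sup>2 \<le> 2 * u\<^sup>2 + 2 * v\<^sup>2" for u v :: real
        using zero_le_power2[of "u - v"] by (simp add: power2_sum power2_diff)
      have "h x - \<phi> x = (h x - p x) + p x * (1 - \<eta> x)" unfolding \<phi>_def by (simp add: algebra_simps)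
      then have "(h x - \<phi> x)\<^sup>2 \<le> 2 * (h x - p x)\<^sup>2 + 2 * (p x * (1 - \<eta> x))\<^sup>2"
        by (simp only: sq_add)
      also have "\<dots> \<le> 2 * (e / 2)\<^sup>2 + 2 * (B\<^sup>2 * (5 * a + 5 * b))"
        using P H by (intro add_mono mult_left_mono) auto
      finally show ?thesis unfolding a_def b_def by (simp add: power_divide algebra_simps)
    qed
    have i: "(\<lambda>x::real. x ^ n) integrable_on {0..1}" "(\<lambda>x::real. (1 - x) ^ n) integrable_on {0..1}"
      by (auto intro!: integrable_continuous_interval continuous_intros)
    have "integral {0..1} ?g = e\<^sup>2 / 2 + 2 * B\<^sup>2 * (10 / (real n + 1))"
      using i by (subst integral_add | (auto intro!: integrable_add integrable_on_mult_right simp: integral_power_01 integral_one_minus_power_01)[1])+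
    also have "\<dots> \<le> e\<^sup>2"
    proof -
      have "40 * B\<^sup>2 < n * e\<^sup>2" using n(1) e by (simp add: field_simps)
      also have "\<dots> \<le> (real n + 1) * e\<^sup>2" by (intro mult_right_mono) auto
      finally show ?thesis by (simp add: field_simps)
    qed
    finally show "integral {0..1} ?g \<le> e\<^sup>2" .
    show "continuous_on {0..1} (\<lambda>x. h x - \<phi> x)" by (intro continuous_intros h \<phi>c)
    show "continuous_on {0..1} ?g" by (intro continuous_intros)
  qed (use e in auto)
  moreover have "continuous_on UNIV \<phi>''"
    using \<phi>''(1) by (simp add: continuous_at_imp_continuous_on continuous_real_polymonial_function)
  moreover have "\<phi> 0 = 0" "\<phi> 1 = 0" by (auto simp: \<phi>_def \<eta>_def)
  ultimately show thesis
    using that[of \<phi> \<phi>' \<phi>''] \<phi>'(2) \<phi>''(2) \<open>\<phi>' 1 = 0\<close> by blast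
qed

section \<open>The gain: continuity and nonzero norm\<close>

text \<open>\<open>I\<^sub>1(s) / s\<close> is an entire function of \<open>s\<^sup>2\<close>, so the gain is continuous up to \<open>y = 1\<close>.\<close>
definition bessel_quot :: "real \<Rightarrow> real" where
  "bessel_quot z = (\<Sum>m. 1 / (fact m * fact (m + 1)) * z ^ m)"

lemma bessel_quot_summable: "summable (\<lambda>m. 1 / (fact m * fact (m + 1)) * z ^ m :: real)"
proof (rule summable_comparison_test')
  show "summable (\<lambda>m. inverse (fact m) * \<bar>z\<bar> ^ m)" by (rule summable_exp)
  show "norm (1 / (fact m * fact (m + 1)) * z ^ m) \<le> inverse (fact m) * \<bar>z\<bar> ^ m" for m
  proof -
    have "1 / (fact m * fact (m + 1)) \<le> (1 / fact m :: real)"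
      using mult_left_mono[OF fact_ge_1[of "m + 1"], of "fact m :: real"]
      by (intro divide_left_mono) auto
    then have "1 / (fact m * fact (m + 1)) * \<bar>z\<bar> ^ m \<le> 1 / fact m * \<bar>z\<bar> ^ m"
      by (rule mult_right_mono) simp
    then show ?thesis by (simp add: abs_mult power_abs inverse_eq_divide del: fact_Suc)
  qed
qed

lemma continuous_bessel_quot: "continuous_on UNIV bessel_quot"
  unfolding bessel_quot_def[abs_def]
  by (intro continuous_at_imp_continuous_on ballI isCont_powser_converges_everywhere
      bessel_quot_summable)

lemma bessel_quot_ge_1: "0 \<le> z \<Longrightarrow> 1 \<le> bessel_quot z"
  using sum_le_suminf[OF bessel_quot_summable[of z], of "{0}"] unfolding bessel_quot_def by simp

lemma bessel_quot_0: "bessel_quot 0 = 1"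
  unfolding bessel_quot_def by (subst powser_zero) simp

lemma bessel_I1_eq: "bessel_I1 s = s / 2 * bessel_quot (s\<^sup>2 / 4)"
proof -
  have eq: "s / 2 * (1 / (fact m * fact (m + 1)) * (s\<^sup>2 / 4) ^ m) =
      (s / 2) ^ (2 * m + 1) / (fact m * fact (m + 1))" for m
  proof -
    have "(s / 2) ^ (2 * m) = (s\<^sup>2 / 4) ^ m" by (simp add: power_mult power_divide)
    then show ?thesis by simp
  qed
  then show ?thesis
    unfolding bessel_I1_def bessel_quot_def
    by (subst suminf_mult[symmetric, OF bessel_quot_summable]) (simp only: eq)
qed

text \<open>Both branches of \<open>kernelK\<close> merge, since \<open>bessel_quot 0 = 1\<close>
  reproduces the value assigned on the diagonal. On [0,1] the radicand is nonnegative, so squaring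
  its root gives it back.\<close>

lemma gain_k_eq:
  assumes "0 \<le> kappa th lam c" "y \<in> {0..1}"
  shows "gain_k th lam c y =
    - y * kappa th lam c / 2 * bessel_quot (kappa th lam c * (1 - y\<^sup>2) / 4)"
proof -
  define r where "r = kappa th lam c * (1 - y\<^sup>2)"
  have r: "0 \<le> r" using assms by (auto simp: r_def power_le_one)
  have "gain_k th lam c y = (if sqrt r = 0 then - y * kappa th lam c / 2
      else - y * kappa th lam c * bessel_I1 (sqrt r) / sqrt r)"
    by (simp add: gain_k_def kernelK_def Let_def r_def)
  then show ?thesis
    unfolding r_def[symmetric] using r by (auto simp: bessel_I1_eq bessel_quot_0)
qed

lemma continuous_on_gain_k:
  assumes "0 \<le> kappa th lam c"
  shows "continuous_on {0..1} (gain_k th lam c)"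
proof -
  have "continuous_on {0..1}
      (\<lambda>y. - y * kappa th lam c / 2 * bessel_quot (kappa th lam c * (1 - y\<^sup>2) / 4))"
    by (intro continuous_intros continuous_on_compose2[OF continuous_bessel_quot]) auto
  then show ?thesis by (rule continuous_on_eq) (simp add: gain_k_eq[OF assms])
qed

text \<open>Keeping only the leading term of the Bessel series gives |k(y)| >= kappa y / 2, whose
  square integrates to kappa^2 / 12. Positivity makes \<beta> ||k|| / 2 an admissible accuracy for
  the approximation of k.\<close>

lemma L2norm_gain_k_pos:
  assumes "0 < kappa th lam c"
  shows "0 < L2norm (gain_k th lam c)"
proof -
  let ?\<kappa> = "kappa th lam c"
  have "0 < (?\<kappa> / 2)\<^sup>2 * (1 / (real 2 + 1))" using assms by simp
  also have "\<dots> = integral {0..1} (\<lambda>y. (?\<kappa> / 2)\<^sup>2 * y\<^sup>2)"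
    unfolding integral_power_01[of 2, symmetric] by simp
  also have "\<dots> \<le> integral {0..1} (\<lambda>y. (gain_k th lam c y)\<^sup>2)"
  proof (rule integral_le)
    fix y :: real assume y: "y \<in> {0..1}"
    have "1 \<le> bessel_quot (?\<kappa> * (1 - y\<^sup>2) / 4)"
      using assms y by (intro bessel_quot_ge_1) (auto simp: power_le_one)
    then have "(?\<kappa> / 2 * y)\<^sup>2 * 1 \<le> (?\<kappa> / 2 * y)\<^sup>2 * (bessel_quot (?\<kappa> * (1 - y\<^sup>2) / 4))\<^sup>2"
      by (intro mult_left_mono) (auto simp: power2_eq_square intro: mult_ge1_I)
    then show "(?\<kappa> / 2)\<^sup>2 * y\<^sup>2 \<le> (gain_k th lam c y)\<^sup>2"
      using assms y by (simp add: gain_k_eq power_mult_distrib power_divide mult_ac)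
  qed (intro integrable_continuous_interval continuous_intros continuous_on_gain_k less_imp_le assms)+
  finally show ?thesis unfolding L2norm_def by simp
qed

section \<open>Solutions under a held boundary value: continuity and weak form\<close>

lemma is_solution_in_L2:
  "is_solution th lam s g U w \<Longrightarrow> s \<le> t \<Longrightarrow> in_L2 (w t)"
  unfolding is_solution_def by blast

lemma is_solution_derivatives:
  assumes "is_solution th lam s g U w"
  obtains wt wx wxx where
    "\<forall>t>s. \<forall>x\<in>{0..1}. ((\<lambda>r. w r x) has_real_derivative wt t x) (at t)"
    "\<forall>t>s. \<forall>x\<in>{0..1}. (w t has_real_derivative wx t x) (at x within {0..1})"
    "\<forall>t>s. \<forall>x\<in>{0..1}. (wx t has_real_derivative wxx t x) (at x within {0..1})"
    "\<forall>t>s. \<forall>x\<in>{0..1}. wt t x = th * wxx t x + lam * w t x"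
    "continuous_on ({s<..} \<times> {0..1}) (\<lambda>(t, x). w t x)"
    "continuous_on ({s<..} \<times> {0..1}) (\<lambda>(t, x). wt t x)"
    "\<forall>t>s. continuous_on {0..1} (wxx t)"
proof -
  obtain wt wx wxx where
    *: "\<forall>t>s. \<forall>x\<in>{0..1}.
         ((\<lambda>r. w r x) has_real_derivative wt t x) (at t) \<and>
         ((\<lambda>\<xi>. w t \<xi>) has_real_derivative wx t x) (at x within {0..1}) \<and>
         ((\<lambda>\<xi>. wx t \<xi>) has_real_derivative wxx t x) (at x within {0..1}) \<and>
         wt t x = th * wxx t x + lam * w t x"
      "continuous_on ({s<..} \<times> {0..1}) (\<lambda>(t, x). w t x)"
      "continuous_on ({s<..} \<times> {0..1}) (\<lambda>(t, x). wt t x)"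
      "\<forall>t>s. continuous_on {0..1} (wxx t)"
    using assms unfolding is_solution_def by (elim conjE exE)
  show thesis
    by (rule that[of wt wx wxx]) (use * in blast)+
qed

text \<open>What matters is the endpoint \<open>s\<close>: the equation holds only after it, while
  the mean value theorem needs continuity on a closed interval. Cauchy-Schwarz transfers the L2
  continuity of the state to its pairings.\<close>

lemma is_solution_pairing_continuous:
  assumes sol: "is_solution th lam s g U w" and h: "in_L2 h"
  shows "continuous_on {s..} (\<lambda>t. integral {0..1} (\<lambda>x. h x * w t x))"
  unfolding continuous_on
proof
  fix t0 assume t0: "t0 \<in> {s..}"
  let ?\<Phi> = "\<lambda>t. integral {0..1} (\<lambda>x. h x * w t x)"
  have "((\<lambda>t. L2norm (\<lambda>y. w t y - w t0 y)) \<longlongrightarrow> 0) (at t0 within {s..})"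
    using sol t0 unfolding is_solution_def by auto
  then have lim: "((\<lambda>t. L2norm h * L2norm (\<lambda>y. w t y - w t0 y)) \<longlongrightarrow> 0) (at t0 within {s..})"
    by (rule tendsto_mult_right_zero)
  have bd: "norm (?\<Phi> t - ?\<Phi> t0) \<le> L2norm h * L2norm (\<lambda>y. w t y - w t0 y)" if "t \<in> {s..}" for t
  proof -
    have L2: "in_L2 (w t)" "in_L2 (w t0)" using is_solution_in_L2[OF sol] t0 that by auto
    have "?\<Phi> t - ?\<Phi> t0 = integral {0..1} (\<lambda>x. h x * (w t x - w t0 x))"
      using in_L2_mult_integrable[OF h] L2 by (simp add: right_diff_distrib integral_diff)
    then show ?thesis using L2_Cauchy_Schwarz[OF h in_L2_diff[OF L2]] by simp
  qed
  have "((\<lambda>t. ?\<Phi> t - ?\<Phi> t0) \<longlongrightarrow> 0) (at t0 within {s..})"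
    using bd by (intro Lim_null_comparison[OF _ lim] eventually_at_topological[THEN iffD2]) auto
  then show "(?\<Phi> \<longlongrightarrow> ?\<Phi> t0) (at t0 within {s..})" by (simp add: LIM_zero_iff)
qed

text \<open>With the lift x U as \<open>h\<close>, this lets the energy estimate start at
  \<open>s\<close> itself, where the state is merely in L2. It is the reverse triangle
  inequality.\<close>

lemma is_solution_norm_continuous:
  assumes sol: "is_solution th lam s g U w" and h: "in_L2 h"
  shows "continuous_on {s..} (\<lambda>t. L2norm (\<lambda>x. w t x - h x))"
  unfolding continuous_on
proof
  fix t0 assume t0: "t0 \<in> {s..}"
  let ?N = "\<lambda>t. L2norm (\<lambda>x. w t x - h x)"
  have lim: "((\<lambda>t. L2norm (\<lambda>y. w t y - w t0 y)) \<longlongrightarrow> 0) (at t0 within {s..})"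
    using sol t0 unfolding is_solution_def by auto
  have bd: "norm (?N t - ?N t0) \<le> L2norm (\<lambda>y. w t y - w t0 y)" if "t \<in> {s..}" for t
  proof -
    have L2: "in_L2 (w t)" "in_L2 (w t0)" using is_solution_in_L2[OF sol] t0 that by auto
    show ?thesis using L2norm_triangle_diff[OF in_L2_diff[OF L2(1) h] in_L2_diff[OF L2(2) h]] by simp
  qed
  have "((\<lambda>t. ?N t - ?N t0) \<longlongrightarrow> 0) (at t0 within {s..})"
    using bd by (intro Lim_null_comparison[OF _ lim] eventually_at_topological[THEN iffD2]) auto
  then show "(?N \<longlongrightarrow> ?N t0) (at t0 within {s..})" by (simp add: LIM_zero_iff)
qed

text \<open>The zeros of \<open>\<phi>\<close> are exactly what removes the uncontrolled boundary fluxes and the held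
  input from the integration by parts.\<close>
lemma is_solution_weak_form:
  assumes sol: "is_solution th lam s g U w" and t: "s < t"
    and \<phi>: "\<And>x. (\<phi> has_real_derivative \<phi>' x) (at x)"
    and \<phi>': "\<And>x. (\<phi>' has_real_derivative \<phi>'' x) (at x)"
    and \<phi>'': "continuous_on UNIV \<phi>''"
    and bc: "\<phi> 0 = 0" "\<phi> 1 = 0" "\<phi>' 1 = 0"
  shows "((\<lambda>r. integral {0..1} (\<lambda>x. \<phi> x * w r x)) has_real_derivative
      integral {0..1} (\<lambda>x. (th * \<phi>'' x + lam * \<phi> x) * w t x)) (at t)"
proof -
  obtain wt wx wxx where
    wt: "\<forall>t>s. \<forall>x\<in>{0..1}. ((\<lambda>r. w r x) has_real_derivative wt t x) (at t)"
    and wx: "\<forall>t>s. \<forall>x\<in>{0..1}. (w t has_real_derivative wx t x) (at x within {0..1})"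
    and wxx: "\<forall>t>s. \<forall>x\<in>{0..1}. (wx t has_real_derivative wxx t x) (at x within {0..1})"
    and pde: "\<forall>t>s. \<forall>x\<in>{0..1}. wt t x = th * wxx t x + lam * w t x"
    and cw2: "continuous_on ({s<..} \<times> {0..1}) (\<lambda>(t, x). w t x)"
    and cwt: "continuous_on ({s<..} \<times> {0..1}) (\<lambda>(t, x). wt t x)"
    and cwxx: "\<forall>t>s. continuous_on {0..1} (wxx t)"
    by (rule is_solution_derivatives[OF sol])
  note wt = wt[rule_format] and wx = wx[rule_format] and wxx = wxx[rule_format]
    and pde = pde[rule_format] and cwxx = cwxx[rule_format]
  have b0: "w t 0 = 0" using sol t unfolding is_solution_def by blast
  have c\<phi>: "continuous_on S \<phi>" for S
    using \<phi> by (meson DERIV_isCont continuous_at_imp_continuous_on)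
  have c\<phi>'': "continuous_on S \<phi>''" for S using \<phi>'' continuous_on_subset by blast
  have cw: "continuous_on {0..1} (w r)" if "r > s" for r
    by (rule DERIV_continuous_on[OF wx[OF that]])
  \<comment> \<open>The half-line \<open>{s<..}\<close> is convex, as the Leibniz rule requires, and
    open, so the derivative within it is the full derivative at \<open>t\<close>.\<close>
  have "((\<lambda>r. integral (cbox 0 1) (\<lambda>x. \<phi> x * w r x)) has_real_derivative
      integral (cbox 0 1) (\<lambda>x. \<phi> x * wt t x)) (at t within {s<..})"
  proof (rule leibniz_rule_field_derivative)
    show "((\<lambda>r. \<phi> x * w r x) has_real_derivative \<phi> x * wt r x) (at r within {s<..})"
      if "r \<in> {s<..}" "x \<in> cbox 0 1" for r x
      using that by (auto intro!: DERIV_cmult has_field_derivative_at_within[OF wt])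
    show "(\<lambda>x. \<phi> x * w r x) integrable_on cbox 0 1" if "r \<in> {s<..}" for r
      using that by (auto intro!: integrable_continuous_interval continuous_intros c\<phi> cw)
    have "continuous_on ({s<..} \<times> cbox 0 1) (\<lambda>p. \<phi> (snd p) * (\<lambda>(t, x). wt t x) p)"
      using cwt by (intro continuous_intros continuous_on_compose2[OF c\<phi>[of UNIV]]) auto
    then show "continuous_on ({s<..} \<times> cbox 0 1) (\<lambda>(r, x). \<phi> x * wt r x)"
      by (simp add: case_prod_unfold)
  qed (use t in auto)
  then have D: "((\<lambda>r. integral {0..1} (\<lambda>x. \<phi> x * w r x)) has_real_derivative
      integral {0..1} (\<lambda>x. \<phi> x * wt t x)) (at t)"
    using t by (simp add: at_within_open[OF _ open_greaterThan])
  \<comment> \<open>Green's identity: both integrations by parts at once, with antiderivative \<phi>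
    w_x - \<phi>' w. The boundary term with \<phi>'(0) is removed by the Dirichlet condition at 0,
    the other three by the zeros of \<open>\<phi>\<close>.\<close>
  have ibp: "((\<lambda>x. \<phi> x * wxx t x - \<phi>'' x * w t x) has_integral
      (\<phi> 1 * wx t 1 - \<phi>' 1 * w t 1) - (\<phi> 0 * wx t 0 - \<phi>' 0 * w t 0)) {0..1}"
  proof (rule fundamental_theorem_of_calculus)
    fix x :: real assume x: "x \<in> {0..1}"
    show "((\<lambda>x. \<phi> x * wx t x - \<phi>' x * w t x) has_vector_derivative
        \<phi> x * wxx t x - \<phi>'' x * w t x) (at x within {0..1})"
      unfolding has_real_derivative_iff_has_vector_derivative[symmetric]
      by (rule derivative_eq_intros has_field_derivative_at_within[OF \<phi>]
          has_field_derivative_at_within[OF \<phi>'] wx[OF t x] wxx[OF t x] refl)+ simp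
  qed simp
  have "integral {0..1} (\<lambda>x. \<phi> x * wt t x) =
      integral {0..1} (\<lambda>x. (th * \<phi>'' x + lam * \<phi> x) * w t x + th * (\<phi> x * wxx t x - \<phi>'' x * w t x))"
    by (rule integral_cong) (simp add: pde t algebra_simps)
  also have "\<dots> = integral {0..1} (\<lambda>x. (th * \<phi>'' x + lam * \<phi> x) * w t x) +
      th * integral {0..1} (\<lambda>x. \<phi> x * wxx t x - \<phi>'' x * w t x)"
    using t by (subst integral_add)
      (auto intro!: integrable_continuous_interval continuous_intros c\<phi> c\<phi>'' cw cwxx)
  also have "integral {0..1} (\<lambda>x. \<phi> x * wxx t x - \<phi>'' x * w t x) = 0"
    using integral_unique[OF ibp] bc b0 by simp
  finally show ?thesis using D by simp
qed

section \<open>Energy growth\<close>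

text \<open>Subtracting the lift \<open>x U\<close> of the held boundary value gives homogeneous Dirichlet data.\<close>
lemma is_solution_energy_derivative:
  assumes sol: "is_solution th lam s g U w" and t: "s < t" and th: "0 \<le> th" and lam: "0 \<le> lam"
  shows "\<exists>D. ((\<lambda>r. integral {0..1} (\<lambda>x. (w r x - x * U)\<^sup>2)) has_real_derivative D) (at t) \<and>
    D \<le> 3 * lam * (integral {0..1} (\<lambda>x. (w t x - x * U)\<^sup>2) + U\<^sup>2)"
proof -
  obtain wt wx wxx where
    wt: "\<forall>t>s. \<forall>x\<in>{0..1}. ((\<lambda>r. w r x) has_real_derivative wt t x) (at t)"
    and wx: "\<forall>t>s. \<forall>x\<in>{0..1}. (w t has_real_derivative wx t x) (at x within {0..1})"
    and wxx: "\<forall>t>s. \<forall>x\<in>{0..1}. (wx t has_real_derivative wxx t x) (at x within {0..1})"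
    and pde: "\<forall>t>s. \<forall>x\<in>{0..1}. wt t x = th * wxx t x + lam * w t x"
    and cw2: "continuous_on ({s<..} \<times> {0..1}) (\<lambda>(t, x). w t x)"
    and cwt: "continuous_on ({s<..} \<times> {0..1}) (\<lambda>(t, x). wt t x)"
    and cwxx: "\<forall>t>s. continuous_on {0..1} (wxx t)"
    by (rule is_solution_derivatives[OF sol])
  note wt = wt[rule_format] and wx = wx[rule_format] and wxx = wxx[rule_format]
    and pde = pde[rule_format] and cwxx = cwxx[rule_format]
  have b: "w t 0 = 0" "w t 1 = U" using sol t unfolding is_solution_def by blast+
  have cw: "continuous_on {0..1} (w r)" if "r > s" for r
    by (rule DERIV_continuous_on[OF wx[OF that]])
  have cwx: "continuous_on {0..1} (wx r)" if "r > s" for r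
    by (rule DERIV_continuous_on[OF wxx[OF that]])
  have cwt1: "continuous_on {0..1} (wt t)"
  proof (rule continuous_on_eq)
    show "continuous_on {0..1} (\<lambda>x. th * wxx t x + lam * w t x)"
      by (intro continuous_intros cwxx cw t)
  qed (simp add: pde t)
  have "((\<lambda>r. integral (cbox 0 1) (\<lambda>x. (w r x - x * U)\<^sup>2)) has_real_derivative
      integral (cbox 0 1) (\<lambda>x. 2 * (w t x - x * U) * wt t x)) (at t within {s<..})"
  proof (rule leibniz_rule_field_derivative)
    show "((\<lambda>r. (w r x - x * U)\<^sup>2) has_real_derivative 2 * (w r x - x * U) * wt r x)
        (at r within {s<..})" if "r \<in> {s<..}" "x \<in> cbox 0 1" for r x
      using that by (auto intro!: derivative_eq_intros has_field_derivative_at_within[OF wt])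
    show "(\<lambda>x. (w r x - x * U)\<^sup>2) integrable_on cbox 0 1" if "r \<in> {s<..}" for r
      using that by (auto intro!: integrable_continuous_interval continuous_intros cw)
    have "continuous_on ({s<..} \<times> cbox 0 1)
        (\<lambda>p. 2 * ((\<lambda>(t, x). w t x) p - snd p * U) * (\<lambda>(t, x). wt t x) p)"
      using cwt cw2 by (intro continuous_intros) auto
    then show "continuous_on ({s<..} \<times> cbox 0 1) (\<lambda>(r, x). 2 * (w r x - x * U) * wt r x)"
      by (simp add: case_prod_unfold)
  qed (use t in auto)
  then have D: "((\<lambda>r. integral {0..1} (\<lambda>x. (w r x - x * U)\<^sup>2)) has_real_derivative
      integral {0..1} (\<lambda>x. 2 * (w t x - x * U) * wt t x)) (at t)"
    using t by (simp add: at_within_open[OF _ open_greaterThan])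
  have ibp: "((\<lambda>x. (wx t x - U)\<^sup>2 + (w t x - x * U) * wxx t x) has_integral
      (w t 1 - 1 * U) * (wx t 1 - U) - (w t 0 - 0 * U) * (wx t 0 - U)) {0..1}"
  proof (rule fundamental_theorem_of_calculus)
    fix x :: real assume x: "x \<in> {0..1}"
    show "((\<lambda>x. (w t x - x * U) * (wx t x - U)) has_vector_derivative
        (wx t x - U)\<^sup>2 + (w t x - x * U) * wxx t x) (at x within {0..1})"
      unfolding has_real_derivative_iff_has_vector_derivative[symmetric]
      by (rule derivative_eq_intros wx[OF t x] wxx[OF t x] refl)+ (simp add: power2_eq_square)
  qed simp
  let ?z = "\<lambda>x. w t x - x * U"
  \<comment> \<open>Adding the nonnegative square of the gradient turns the diffusion term into the
    exact derivative of \<open>ibp\<close>, which integrates to 0 since the lifted state vanishes at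
    both ends. The reaction term uses 2 z w = 2 z^2 + 2 z x U <= 3 z^2 + U^2.\<close>
  let ?f = "\<lambda>x. 2 * th * ((wx t x - U)\<^sup>2 + ?z x * wxx t x) + (3 * lam * (?z x)\<^sup>2 + lam * U\<^sup>2)"
  have "integral {0..1} (\<lambda>x. 2 * ?z x * wt t x) \<le> integral {0..1} ?f"
  proof (rule integral_le)
    fix x :: real assume x: "x \<in> {0..1}"
    have "2 * ?z x * (x * U) \<le> (?z x)\<^sup>2 + (x * U)\<^sup>2" by (rule sum_squares_bound)
    moreover have "x\<^sup>2 * U\<^sup>2 \<le> U\<^sup>2" using x by (intro mult_left_le_one_le) (auto simp: power_le_one)
    ultimately have "2 * ?z x * w t x \<le> 3 * (?z x)\<^sup>2 + U\<^sup>2"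
      by (simp add: power2_eq_square algebra_simps)
    then have "lam * (2 * ?z x * w t x) \<le> lam * (3 * (?z x)\<^sup>2 + U\<^sup>2)"
      using lam by (rule mult_left_mono)
    moreover have "0 \<le> 2 * th * (wx t x - U)\<^sup>2" using th by simp
    moreover have "2 * ?z x * wt t x = 2 * th * (?z x * wxx t x) + lam * (2 * ?z x * w t x)"
      using pde[OF t x] by (simp add: algebra_simps)
    ultimately show "2 * ?z x * wt t x \<le> ?f x" unfolding distrib_left by linarith
  qed (intro integrable_continuous_interval continuous_intros cw cwx cwxx cwt1 t)+
  also have "\<dots> = 2 * th * integral {0..1} (\<lambda>x. (wx t x - U)\<^sup>2 + ?z x * wxx t x) +
      (3 * lam * integral {0..1} (\<lambda>x. (?z x)\<^sup>2) + lam * U\<^sup>2)"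
  proof (subst integral_add)
    show "(\<lambda>x. 2 * th * ((wx t x - U)\<^sup>2 + ?z x * wxx t x)) integrable_on {0..1}"
      "(\<lambda>x. 3 * lam * (?z x)\<^sup>2 + lam * U\<^sup>2) integrable_on {0..1}"
      by (intro integrable_continuous_interval continuous_intros cw cwx cwxx t)+
    have "integral {0..1} (\<lambda>x. 3 * lam * (?z x)\<^sup>2 + lam * U\<^sup>2) =
        3 * lam * integral {0..1} (\<lambda>x. (?z x)\<^sup>2) + lam * U\<^sup>2"
      by (subst integral_add)
         (auto intro!: integrable_continuous_interval continuous_intros cw t)
    then show "integral {0..1} (\<lambda>x. 2 * th * ((wx t x - U)\<^sup>2 + ?z x * wxx t x)) +
        integral {0..1} (\<lambda>x. 3 * lam * (?z x)\<^sup>2 + lam * U\<^sup>2) =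
        2 * th * integral {0..1} (\<lambda>x. (wx t x - U)\<^sup>2 + ?z x * wxx t x) +
        (3 * lam * integral {0..1} (\<lambda>x. (?z x)\<^sup>2) + lam * U\<^sup>2)"
      by simp
  qed
  also have "integral {0..1} (\<lambda>x. (wx t x - U)\<^sup>2 + ?z x * wxx t x) = 0"
    using integral_unique[OF ibp] b by simp
  \<comment> \<open>Enlarging the coefficient of U^2 makes the bound a multiple of energy plus
    U^2.\<close>
  also have "lam * U\<^sup>2 \<le> 3 * lam * U\<^sup>2" using lam by (intro mult_right_mono) auto
  finally show ?thesis using D by (auto simp: distrib_left)
qed

text \<open>Gronwall by an integrating factor. As U is held constant, adding U^2 leaves the
  derivative of the energy unchanged and makes the differential inequality homogeneous.\<close>

lemma is_solution_energy_growth: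
  assumes sol: "is_solution th lam s g U w" and t: "s \<le> t" and th: "0 \<le> th" and lam: "0 \<le> lam"
  shows "(L2norm (\<lambda>x. w t x - x * U))\<^sup>2 + U\<^sup>2 \<le>
    exp (3 * lam * (t - s)) * ((L2norm (\<lambda>x. w s x - x * U))\<^sup>2 + U\<^sup>2)"
proof -
  let ?E = "\<lambda>r. (L2norm (\<lambda>x. w r x - x * U))\<^sup>2"
  let ?G = "\<lambda>r. exp (- (3 * lam) * (r - s)) * (?E r + U\<^sup>2)"
  have cE: "continuous_on {s..t} (\<lambda>r. L2norm (\<lambda>x. w r x - x * U))"
    by (rule continuous_on_subset[OF is_solution_norm_continuous[OF sol]])
       (auto intro!: in_L2_continuous continuous_intros)
  have "?G t \<le> ?G s"
  proof (rule DERIV_nonpos_imp_decreasing_open[OF t])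
    show "continuous_on {s..t} ?G" by (intro continuous_intros cE)
    fix r assume r: "s < r" "r < t"
    obtain D where D: "(?E has_real_derivative D) (at r)" "D \<le> 3 * lam * (?E r + U\<^sup>2)"
      using is_solution_energy_derivative[OF sol r(1) th lam] unfolding L2norm_sq by blast
    have e: "((\<lambda>r. exp (- (3 * lam) * (r - s))) has_real_derivative
        exp (- (3 * lam) * (r - s)) * (- (3 * lam))) (at r)"
      by (auto intro!: derivative_eq_intros)
    have "(?G has_real_derivative
        exp (- (3 * lam) * (r - s)) * (D - 3 * lam * (?E r + U\<^sup>2))) (at r)"
      by (rule DERIV_cong[OF DERIV_mult[OF e DERIV_add[OF D(1) DERIV_const]]])
         (simp add: algebra_simps)
    moreover have "exp (- (3 * lam) * (r - s)) * (D - 3 * lam * (?E r + U\<^sup>2)) \<le> 0"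
      using D(2) by (intro mult_nonneg_nonpos) auto
    ultimately show "\<exists>y. (?G has_real_derivative y) (at r) \<and> y \<le> 0" by blast
  qed
  then have le: "?G t \<le> ?E s + U\<^sup>2" by simp
  have "?E t + U\<^sup>2 = exp (3 * lam * (t - s)) * ?G t"
    unfolding mult.assoc[symmetric] exp_add[symmetric] by simp
  also have "\<dots> \<le> exp (3 * lam * (t - s)) * (?E s + U\<^sup>2)" using le by (rule mult_left_mono) simp
  finally show ?thesis .
qed

text \<open>The energy bound is carried back through the lift, at a cost of ||x U|| <= |U| at both
  times.\<close>

lemma is_solution_norm_growth:
  assumes sol: "is_solution th lam s g U w" and t: "s \<le> t" and th: "0 \<le> th" and lam: "0 \<le> lam"
  shows "L2norm (w t) \<le> 2 * exp (3 * lam * (t - s)) * (L2norm (w s) + \<bar>U\<bar>)"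
proof (rule power2_le_imp_le)
  let ?z = "\<lambda>r x. w r x - x * U" and ?e = "exp (3 * lam * (t - s))"
  have id: "in_L2 (\<lambda>x. x * U)" by (intro in_L2_continuous continuous_intros)
  have idU: "L2norm (\<lambda>x. x * U) \<le> \<bar>U\<bar>"
  proof (rule L2norm_le)
    show "(x * U)\<^sup>2 \<le> U\<^sup>2" if "x \<in> {0..1}" for x :: real
      using that by (auto simp: power_mult_distrib power_le_one intro!: mult_left_le_one_le)
  qed (auto intro!: continuous_intros)
  have L2: "in_L2 (w s)" "in_L2 (w t)" using is_solution_in_L2[OF sol] t by auto
  have "L2norm (\<lambda>x. ?z t x + x * U) \<le> L2norm (?z t) + L2norm (\<lambda>x. x * U)"
    by (intro L2norm_triangle in_L2_diff L2 id)
  then have wt: "L2norm (w t) \<le> L2norm (?z t) + \<bar>U\<bar>" using idU by simp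
  have "L2norm (\<lambda>x. w s x + (-1) * (x * U)) \<le> L2norm (w s) + L2norm (\<lambda>x. (-1) * (x * U))"
    by (intro L2norm_triangle in_L2_cmult L2 id)
  then have zs: "L2norm (?z s) \<le> L2norm (w s) + \<bar>U\<bar>" unfolding L2norm_cmult using idU by simp
  have "\<bar>U\<bar>\<^sup>2 \<le> (L2norm (w s) + \<bar>U\<bar>)\<^sup>2" by (intro power_mono) auto
  then have U: "U\<^sup>2 \<le> (L2norm (w s) + \<bar>U\<bar>)\<^sup>2" by simp
  have e: "1 \<le> ?e" using t lam by simp
  have "(L2norm (w t))\<^sup>2 \<le> (L2norm (?z t) + \<bar>U\<bar>)\<^sup>2" using wt by (rule power_mono) simp
  also have "\<dots> \<le> 2 * ((L2norm (?z t))\<^sup>2 + U\<^sup>2)"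
    using sum_squares_bound[of "L2norm (?z t)" "\<bar>U\<bar>"] by (simp add: power2_sum)
  also have "\<dots> \<le> 2 * (?e * ((L2norm (?z s))\<^sup>2 + U\<^sup>2))"
    using is_solution_energy_growth[OF assms] by simp
  also have "\<dots> \<le> 2 * (?e * ((L2norm (w s) + \<bar>U\<bar>)\<^sup>2 + (L2norm (w s) + \<bar>U\<bar>)\<^sup>2))"
    by (intro mult_left_mono add_mono power_mono[OF zs] U) auto
  also have "\<dots> = 4 * (?e * 1) * (L2norm (w s) + \<bar>U\<bar>)\<^sup>2" by simp
  \<comment> \<open>One factor 2 comes from squaring a sum, the other from bounding both energy
    terms by the same square. Since \<open>?e\<close> is at least 1, passing to its square makes the
    right side a perfect square.\<close>
  also have "\<dots> \<le> 4 * (?e * ?e) * (L2norm (w s) + \<bar>U\<bar>)\<^sup>2"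
    using e by (intro mult_right_mono mult_left_mono) auto
  also have "\<dots> = (2 * ?e * (L2norm (w s) + \<bar>U\<bar>))\<^sup>2" by (simp add: power2_eq_square)
  finally show "(L2norm (w t))\<^sup>2 \<le> (2 * ?e * (L2norm (w s) + \<bar>U\<bar>))\<^sup>2" .
qed simp

text \<open>The control is computed from \<open>g\<close>, while the trigger measures
  \<open>w s\<close>; the two agree on [0,1], the only place the integral looks.\<close>

lemma held_control_bound:
  assumes sol: "is_solution th lam s g (held_control th lam c g) w" and \<kappa>: "0 \<le> kappa th lam c"
  shows "\<bar>held_control th lam c g\<bar> \<le> L2norm (gain_k th lam c) * L2norm (w s)"
proof -
  have "held_control th lam c g = integral {0..1} (\<lambda>y. gain_k th lam c y * w s y)"
    unfolding held_control_def
    using sol by (intro integral_cong) (auto simp: is_solution_def)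
  then show ?thesis
    using L2_Cauchy_Schwarz[OF in_L2_continuous[OF continuous_on_gain_k[OF \<kappa>]]
        is_solution_in_L2[OF sol order_refl]] by simp
qed

section \<open>Dwell time and conclusion\<close>

text \<open>\<open>\<tau>\<close> is fixed before \<open>s\<close>, \<open>g\<close> and
  \<open>w\<close>, so one value serves all segments. The bound concerns every trigger point, so it
  passes to the infimum whether or not that is attained.\<close>

lemma trigger_dwell_time:
  assumes th: "0 < th" and lam: "0 \<le> lam" and \<kappa>: "0 < kappa th lam c" and \<beta>: "0 < \<beta>"
  obtains \<tau> where "0 < \<tau>"
    and "\<And>s g w t. is_solution th lam s g (held_control th lam c g) w \<Longrightarrow>
      t \<in> trigger_set th lam c \<beta> s w \<Longrightarrow> s + \<tau> \<le> t"
proof -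
  let ?k = "gain_k th lam c"
  define K where "K = L2norm ?k"
  have K: "0 < K" unfolding K_def by (rule L2norm_gain_k_pos[OF \<kappa>])
  have ck: "continuous_on {0..1} ?k" using \<kappa> by (intro continuous_on_gain_k) simp
  obtain \<phi> \<phi>' \<phi>'' where
    \<phi>: "\<And>x. (\<phi> has_real_derivative \<phi>' x) (at x)" "\<And>x. (\<phi>' has_real_derivative \<phi>'' x) (at x)"
      "continuous_on UNIV \<phi>''" "\<phi> 0 = 0" "\<phi> 1 = 0" "\<phi>' 1 = 0"
    and k\<phi>: "L2norm (\<lambda>x. ?k x - \<phi> x) \<le> \<beta> * K / 2"
    using L2_dense_test_polynomials[OF ck, of "\<beta> * K / 2"] \<beta> K by auto
  define \<psi> where "\<psi> = (\<lambda>x. th * \<phi>'' x + lam * \<phi> x)"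
  have c\<phi>: "continuous_on {0..1} \<phi>"
    using \<phi>(1) by (meson DERIV_isCont continuous_at_imp_continuous_on)
  have c\<phi>'': "continuous_on {0..1} \<phi>''" using \<phi>(3) continuous_on_subset by blast
  have L2\<phi>: "in_L2 \<phi>" and L2\<psi>: "in_L2 \<psi>" and L2k: "in_L2 ?k"
    unfolding \<psi>_def by (intro in_L2_continuous continuous_intros c\<phi> c\<phi>'' ck)+
  \<comment> \<open>The speed of <\<phi>, w> on a unit interval after \<open>s\<close>, per unit of
    ||w s||: Cauchy-Schwarz against \<open>\<psi>\<close>, then the growth bound with |U| <= K ||w
    s||.\<close>
  define M where "M = L2norm \<psi> * (2 * exp (3 * lam) * (1 + K))"
  have M: "0 \<le> M" unfolding M_def using K by simp
  \<comment> \<open>The cap 1 keeps the growth factor below exp(3 lam); dividing by M + 1 covers M =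
    0.\<close>
  define \<tau> where "\<tau> = min 1 (\<beta> * K / 2 / (M + 1))"
  have \<tau>: "0 < \<tau>" "\<tau> \<le> 1" unfolding \<tau>_def using \<beta> K M by auto
  have M\<tau>: "M * \<tau> \<le> \<beta> * K / 2"
  proof -
    have "\<tau> \<le> \<beta> * K / 2 / (M + 1)" unfolding \<tau>_def by simp
    then have "\<tau> * (M + 1) \<le> \<beta> * K / 2" using M by (subst (asm) pos_le_divide_eq) auto
    then show ?thesis using \<tau>(1) by (simp add: algebra_simps)
  qed
  show thesis
  proof (rule that[OF \<tau>(1)], rule ccontr)
    fix s g w t
    assume sol: "is_solution th lam s g (held_control th lam c g) w"
      and trig: "t \<in> trigger_set th lam c \<beta> s w" and early: "\<not> s + \<tau> \<le> t"
    define V where "V = L2norm (w s)"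
    have V: "0 \<le> V" unfolding V_def by simp
    have st: "s < t" using trig unfolding trigger_set_def by simp
    have L2: "in_L2 (w s)" "in_L2 (w t)" using is_solution_in_L2[OF sol] st by auto
    let ?\<Phi> = "\<lambda>r. integral {0..1} (\<lambda>x. \<phi> x * w r x)"
    have growth: "L2norm (w r) \<le> 2 * exp (3 * lam) * (1 + K) * V" if "s \<le> r" "r \<le> t" for r
    proof -
      have "3 * lam * (r - s) \<le> 3 * lam * 1"
        using that early \<tau>(2) lam by (intro mult_left_mono) auto
      then have "2 * exp (3 * lam * (r - s)) * (L2norm (w s) + \<bar>held_control th lam c g\<bar>)
          \<le> 2 * exp (3 * lam) * (V + K * V)"
        using held_control_bound[OF sol less_imp_le[OF \<kappa>]] unfolding V_def K_def
        by (intro mult_mono add_mono) auto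
      also have "\<dots> = 2 * exp (3 * lam) * (1 + K) * V" by (simp add: algebra_simps)
      finally show ?thesis
        using is_solution_norm_growth[OF sol that(1) less_imp_le[OF th] lam] by linarith
    qed
    have weak: "(?\<Phi> has_real_derivative integral {0..1} (\<lambda>x. \<psi> x * w r x)) (at r)"
      if "s < r" for r
      unfolding \<psi>_def by (rule is_solution_weak_form[OF sol that \<phi>])
    have "continuous_on {s..t} ?\<Phi>"
      by (rule continuous_on_subset[OF is_solution_pairing_continuous[OF sol L2\<phi>]]) auto
    moreover have "?\<Phi> differentiable (at r)" if "s < r" for r
      using weak[OF that] unfolding real_differentiable_def by blast
    ultimately obtain l r where r: "s < r" "r < t"
      and l: "(?\<Phi> has_real_derivative l) (at r)" "?\<Phi> t - ?\<Phi> s = (t - s) * l"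
      using MVT[OF st, of ?\<Phi>] by blast
    have mvt: "?\<Phi> t - ?\<Phi> s = (t - s) * integral {0..1} (\<lambda>x. \<psi> x * w r x)"
      using l(2) DERIV_unique[OF l(1) weak[OF r(1)]] by simp
    have "\<bar>integral {0..1} (\<lambda>x. \<psi> x * w r x)\<bar> \<le> L2norm \<psi> * L2norm (w r)"
      using L2_Cauchy_Schwarz[OF L2\<psi> is_solution_in_L2[OF sol]] r by simp
    also have "\<dots> \<le> L2norm \<psi> * (2 * exp (3 * lam) * (1 + K) * V)"
      using growth r by (intro mult_left_mono) auto
    also have "\<dots> = M * V" by (simp add: M_def)
    finally have "\<bar>?\<Phi> s - ?\<Phi> t\<bar> \<le> \<tau> * (M * V)"
      unfolding abs_minus_commute[of "?\<Phi> s"] mvt abs_mult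
      using st early M V by (intro mult_mono) auto
    also have "\<dots> \<le> \<beta> * K / 2 * V" using mult_right_mono[OF M\<tau> V] by (simp add: mult_ac)
    finally have smooth: "\<bar>?\<Phi> s - ?\<Phi> t\<bar> \<le> \<beta> * K / 2 * V" .
    have L2r: "in_L2 (\<lambda>x. ?k x - \<phi> x)" by (intro in_L2_diff L2k L2\<phi>)
    have rough: "\<bar>integral {0..1} (\<lambda>x. (?k x - \<phi> x) * w r x)\<bar> \<le> \<beta> * K / 2 * L2norm (w r)"
      if "in_L2 (w r)" for r
      using L2_Cauchy_Schwarz[OF L2r that] mult_right_mono[OF k\<phi>, of "L2norm (w r)"] by simp
    have "integral {0..1} (\<lambda>y. ?k y * (w s y - w t y)) =
        integral {0..1} (\<lambda>y. ((?k y - \<phi> y) * w s y + \<phi> y * w s y) - ((?k y - \<phi> y) * w t y + \<phi> y * w t y))"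
      by (simp add: algebra_simps)
    also have "\<dots> = (integral {0..1} (\<lambda>x. (?k x - \<phi> x) * w s x) + ?\<Phi> s)
        - (integral {0..1} (\<lambda>x. (?k x - \<phi> x) * w t x) + ?\<Phi> t)"
      by (simp only: integral_diff integral_add integrable_add in_L2_mult_integrable L2 L2r L2\<phi>)
    \<comment> \<open>The budget: the rough part at \<open>s\<close> and the smooth drift each take
      half of the ||w s|| term, and the rough part at \<open>t\<close> takes half of the ||w t||
      term.\<close>
    finally have "\<bar>integral {0..1} (\<lambda>y. ?k y * (w s y - w t y))\<bar>
        \<le> \<beta> * K / 2 * V + \<beta> * K / 2 * V + \<beta> * K / 2 * L2norm (w t)"
      using smooth rough[OF L2(1)] rough[OF L2(2)] unfolding V_def by linarith
    also have "\<dots> \<le> \<beta> * K * V + \<beta> * K * L2norm (w t)" using \<beta> K by simp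
    finally show False using trig unfolding trigger_set_def K_def V_def by simp
  qed
qed

theorem theorem1:
  fixes \<theta> lam c \<beta> :: real
  assumes "\<theta> > 0" and "lam \<ge> \<theta> * pi\<^sup>2" and "c \<ge> 0" and "\<beta> > 0"
  shows "\<exists>\<tau>>0. \<forall>u0 tt ws.
           in_L2 u0 \<and> event_triggered_closed_loop \<theta> lam c \<beta> u0 tt ws \<longrightarrow>
           (\<forall>j. tt (Suc j) \<noteq> \<infinity> \<longrightarrow> ereal \<tau> \<le> tt (Suc j) - tt j)"
proof -
  have "0 < \<theta> * pi\<^sup>2" using assms(1) by simp
  with assms have lam: "0 < lam" by linarith
  then have \<kappa>: "0 < kappa \<theta> lam c" using assms unfolding kappa_def by simp
  obtain \<tau> where \<tau>: "0 < \<tau>"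
    and dwell: "\<And>s g w t. is_solution \<theta> lam s g (held_control \<theta> lam c g) w \<Longrightarrow>
      t \<in> trigger_set \<theta> lam c \<beta> s w \<Longrightarrow> s + \<tau> \<le> t"
    using trigger_dwell_time[OF assms(1) less_imp_le[OF lam] \<kappa> assms(4)] by metis
  show ?thesis
  proof (intro exI[of _ \<tau>] conjI allI impI)
    fix u0 tt ws j
    assume "in_L2 u0 \<and> event_triggered_closed_loop \<theta> lam c \<beta> u0 tt ws" and fin: "tt (Suc j) \<noteq> \<infinity>"
    then have cl: "event_triggered_closed_loop \<theta> lam c \<beta> u0 tt ws" by simp
    define s where "s = real_of_ereal (tt j)"
    define g where "g = (if j = 0 then u0 else ws (j - 1) s)"
    let ?S = "trigger_set \<theta> lam c \<beta> s (ws j)"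
    \<comment> \<open>Contrapositive of the rule that an infinite event time is followed only by
      infinite ones.\<close>
    have tj: "tt j \<noteq> \<infinity>" using cl fin unfolding event_triggered_closed_loop_def by blast
    then have sol: "is_solution \<theta> lam s g (held_control \<theta> lam c g) (ws j)"
      and "tt (Suc j) = (if ?S = {} then \<infinity> else ereal (Inf ?S))"
      using cl unfolding event_triggered_closed_loop_def Let_def s_def g_def by blast+
    with fin have ne: "?S \<noteq> {}" and next_event: "tt (Suc j) = ereal (Inf ?S)" by (auto split: if_splits)
    have "s + \<tau> \<le> Inf ?S" using ne dwell[OF sol] by (rule cInf_greatest)
    \<comment> \<open>The case split also meets \<open>tt j\<close> = -infinity; there the
      difference is +infinity, so no induction on \<open>j\<close> is required to rule it
      out.\<close>
    then show "ereal \<tau> \<le> tt (Suc j) - tt j"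
      unfolding next_event using tj by (cases "tt j") (auto simp: s_def)
  qed (rule \<tau>)
qed

end
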